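(* Let $D$ be a division ring algebraic over its center $F$. Then at least one of the following assertions holds: (1) every maximal subfield of $D$ is self-invariant; (2) $D$ contains a centrally finite non-commutative subdivision ring.
   Context: $D$ is algebraic over its center $F$ if every element of $D$ is a root of a non-zero polynomial with coefficients in $F$. A division ring is centrally finite if it is finite dimensional over its own center. A maximal subfield of $D$ is a field $K\subseteq D$ containing $F$ with $C_D(K)=K$, where $C_D(K)$ is the centralizer of $K$ in $D$. A subfield $K$ of $D$ is self-invariant if $N_{D^*}(K^* )\cup\{0\}=K$, where $D^*=D\setminus\{0\}$, $K^*=K\setminus\{0\}$, and $N_{D^*}(A)=\{b\in D^*: bAb^{-1}\subseteq A\}$. *)

theory Defs
  imports "HOL-Algebra.Algebra"
begin

text \<open>Together with the ring axioms, the assumption below already implies that one differs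
  from zero, because one is always a unit.\<close>

locale division_ring = ring +
  assumes division_ring_Units: "Units R = carrier R - {\<zero>}"

definition subdivision_ring :: "'a set \<Rightarrow> ('a, 'b) ring_scheme \<Rightarrow> bool"
  where "subdivision_ring E R \<longleftrightarrow> subring E R \<and> division_ring (R \<lparr> carrier := E \<rparr>)"

definition noncommutative :: "('a, 'b) ring_scheme \<Rightarrow> bool"
  where "noncommutative R \<longleftrightarrow>
    (\<exists>x \<in> carrier R. \<exists>y \<in> carrier R. x \<otimes>\<^bsub>R\<^esub> y \<noteq> y \<otimes>\<^bsub>R\<^esub> x)"

definition centralizer :: "('a, 'b) ring_scheme \<Rightarrow> 'a set \<Rightarrow> 'a set"
  where "centralizer R A = {x \<in> carrier R. \<forall>a \<in> A. x \<otimes>\<^bsub>R\<^esub> a = a \<otimes>\<^bsub>R\<^esub> x}"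

definition center :: "('a, 'b) ring_scheme \<Rightarrow> 'a set"
  where "center R = centralizer R (carrier R)"

text \<open>The library predicate \<open>algebraic\<close> is non-injectivity of evaluation, which need not be a
  homomorphism over a non-commutative ring for arbitrary coefficient sets; hence the explicit root.\<close>

definition algebraic_over_center :: "('a, 'b) ring_scheme \<Rightarrow> bool"
  where "algebraic_over_center R \<longleftrightarrow>
    (\<forall>x \<in> carrier R. \<exists>p \<in> carrier ((center R)[X]\<^bsub>R\<^esub>).
       p \<noteq> \<zero>\<^bsub>(center R)[X]\<^bsub>R\<^esub>\<^esub> \<and> ring.eval R p x = \<zero>\<^bsub>R\<^esub>)"

definition centrally_finite :: "('a, 'b) ring_scheme \<Rightarrow> bool"
  where "centrally_finite R \<longleftrightarrow> ring.finite_dimension R (center R) (carrier R)"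

definition maximal_subfield :: "'a set \<Rightarrow> ('a, 'b) ring_scheme \<Rightarrow> bool"
  where "maximal_subfield K R \<longleftrightarrow> subfield K R \<and> center R \<subseteq> K \<and> centralizer R K = K"

text \<open>Only an inclusion is required of the conjugate, unlike in the library's \<open>normalizer\<close>.\<close>

definition mult_normalizer :: "('a, 'b) ring_scheme \<Rightarrow> 'a set \<Rightarrow> 'a set"
  where "mult_normalizer R A =
    {b \<in> carrier R - {\<zero>\<^bsub>R\<^esub>}. (\<lambda>a. b \<otimes>\<^bsub>R\<^esub> a \<otimes>\<^bsub>R\<^esub> inv\<^bsub>R\<^esub> b) ` A \<subseteq> A}"

definition self_invariant :: "'a set \<Rightarrow> ('a, 'b) ring_scheme \<Rightarrow> bool"
  where "self_invariant K R \<longleftrightarrow>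
    mult_normalizer R (K - {\<zero>\<^bsub>R\<^esub>}) \<union> {\<zero>\<^bsub>R\<^esub>} = K"

end

theory Submission
  imports Defs
begin

text \<open>Suppose that a maximal subfield \<open>K\<close> is not self-invariant. Then some nonzero \<open>b\<close> outside \<open>K\<close>
  conjugates \<open>K\<close> into itself, and since \<open>K\<close> is its own centralizer, \<open>b\<close> moves some \<open>a \<in> K\<close>. The pair
  \<open>a, b\<close> generates a non-commutative ring, and the point is to enclose it in one that is finite
  dimensional over the center \<open>F\<close>.

  Conjugation by \<open>b\<close> fixes \<open>F\<close>, so it permutes the roots in \<open>K\<close> of any nonzero polynomial over \<open>F\<close>. As \<open>a\<close> is
  algebraic, it lies in the field \<open>L\<close> generated over \<open>F\<close> by the finitely many roots in \<open>K\<close> of one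
  polynomial, and \<open>L\<close> is both finite dimensional over \<open>F\<close> and stable under conjugation by \<open>b\<close>
  (\<open>finite_stable_subfield\<close>). Stability lets \<open>b\<close> be moved past coefficients in \<open>L\<close>, so the left
  \<open>L\<close>-span of the powers of \<open>b\<close> is a ring; as \<open>b\<close> is algebraic, finitely many powers suffice
  (\<open>finite_dimensional_skew_extension\<close>).

  The resulting ring \<open>E\<close> is a division ring because it contains \<open>F\<close> and every element is algebraic
  over \<open>F\<close> (\<open>subring_is_subdivision_ring\<close>). It is finite dimensional over \<open>F\<close> by the tower law, hence
  also over its own center, which contains \<open>F\<close> (\<open>centrally_finite_of_finite_dimension\<close>).\<close>

section \<open>Division rings and their centers\<close>

lemma (in division_ring) nonzero_inv [simp]:
  assumes "x \<in> carrier R" "x \<noteq> \<zero>"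
  shows "inv x \<in> carrier R" "x \<otimes> inv x = \<one>" "inv x \<otimes> x = \<one>"
  using assms division_ring_Units by auto

lemma (in ring) algebraic_over_centerE:
  assumes "algebraic_over_center R" "x \<in> carrier R"
  obtains p where "p \<in> carrier ((center R)[X])" "p \<noteq> []" "eval p x = \<zero>"
  using assms that unfolding algebraic_over_center_def univ_poly_zero[of R "center R"] by metis

lemma (in division_ring) one_not_zero: "\<one> \<noteq> \<zero>"
  using Units_one_closed unfolding division_ring_Units by blast

lemma (in division_ring) integral_division:
  assumes "x \<in> carrier R" "y \<in> carrier R" "x \<otimes> y = \<zero>" "y \<noteq> \<zero>"
  shows "x = \<zero>"
proof -
  have "x = (x \<otimes> y) \<otimes> inv y"
    using assms(1,2,4) by (simp add: m_assoc)
  with assms show ?thesis by simp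
qed

lemma center_incl: "center R \<subseteq> carrier R"
  unfolding center_def centralizer_def by auto

lemma center_comm:
  assumes "z \<in> center R" "x \<in> carrier R"
  shows "z \<otimes>\<^bsub>R\<^esub> x = x \<otimes>\<^bsub>R\<^esub> z"
  using assms unfolding center_def centralizer_def by auto

lemma (in ring) center_is_subring: "subring (center R) R"
proof (rule subringI)
  fix g h assume "g \<in> center R" "h \<in> center R"
  then have car: "g \<in> carrier R" "h \<in> carrier R"
    and comm: "\<And>x. x \<in> carrier R \<Longrightarrow> g \<otimes> x = x \<otimes> g" "\<And>x. x \<in> carrier R \<Longrightarrow> h \<otimes> x = x \<otimes> h"
    using center_incl center_comm by fast+
  have "(g \<otimes> h) \<otimes> x = x \<otimes> (g \<otimes> h)" if "x \<in> carrier R" for x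
    using that car comm by (metis m_assoc)
  with car show "g \<otimes> h \<in> center R"
    unfolding center_def centralizer_def by auto
  show "g \<oplus> h \<in> center R"
    using car comm unfolding center_def centralizer_def by (auto simp: l_distr r_distr)
  show "\<ominus> g \<in> center R"
    using car comm unfolding center_def centralizer_def by (auto simp: l_minus r_minus)
qed (auto simp: center_def centralizer_def)

lemma (in division_ring) center_is_subfield: "subfield (center R) R"
proof (rule subfieldI)
  show "subcring (center R) R"
  proof (rule subcringI[OF center_is_subring])
    fix g h assume "g \<in> center R" "h \<in> center R"
    then show "g \<otimes> h = h \<otimes> g"
      using center_comm[of g R h] center_incl[of R] by blast
  qed
  show "Units (R \<lparr> carrier := center R \<rparr>) = center R - {\<zero>}"
  proof
    show "Units (R \<lparr> carrier := center R \<rparr>) \<subseteq> center R - {\<zero>}"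
      using center_incl[of R] one_not_zero unfolding Units_def by force
    show "center R - {\<zero>} \<subseteq> Units (R \<lparr> carrier := center R \<rparr>)"
    proof
      fix z assume z: "z \<in> center R - {\<zero>}"
      then have car: "z \<in> carrier R" "z \<noteq> \<zero>"
        using center_incl[of R] by auto
      have "inv z \<otimes> x = x \<otimes> inv z" if x: "x \<in> carrier R" for x
      proof -
        have "inv z \<otimes> x = inv z \<otimes> (x \<otimes> z) \<otimes> inv z"
          using x car by (simp add: m_assoc)
        also have "\<dots> = inv z \<otimes> (z \<otimes> x) \<otimes> inv z"
          using center_comm[of z R x] z x by simp
        also have "\<dots> = x \<otimes> inv z"
          using x car by (simp add: m_assoc[symmetric])
        finally show ?thesis .
      qed
      then have "inv z \<in> center R"
        using car unfolding center_def centralizer_def by auto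
      with z car show "z \<in> Units (R \<lparr> carrier := center R \<rparr>)"
        unfolding Units_def by (auto intro!: bexI[of _ "inv z"])
    qed
  qed
qed

section \<open>Subrings of algebraic division rings\<close>

text \<open>If the relation \<open>p(x) = 0\<close> has a nonzero constant term \<open>c\<close>, it reads \<open>y x = - c\<close> with \<open>y\<close> a
  polynomial expression in \<open>x\<close>, and dividing by \<open>- c\<close> exhibits the inverse of \<open>x\<close> as such an
  expression. If \<open>c = 0\<close>, the factor \<open>x\<close> cancels and the degree drops.\<close>

lemma (in division_ring) inv_in_subring_of_algebraic:
  assumes E: "subring E R" and F: "subfield F R" "F \<subseteq> E"
    and x: "x \<in> E" "x \<noteq> \<zero>"
    and p: "p \<in> carrier (F[X])" "p \<noteq> []" "eval p x = \<zero>"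
  shows "inv x \<in> E"
proof -
  note E_closed = subringE[OF E]
  have eval_in: "eval q x \<in> E" if "set q \<subseteq> F" for q
    using that F(2) x(1) E_closed(2,6,7)
      monoid.nat_pow_closed[OF ring.is_monoid[OF subring_is_ring[OF E]], of x]
    by (induct q) (auto simp: nat_pow_consistent[symmetric])
  have car: "x \<in> carrier R" "F \<subseteq> carrier R"
    using x(1) E_closed(1) F(2) by auto
  have "polynomial F p"
    using p(1) univ_poly_carrier by blast
  then have "set p \<subseteq> F" "p \<noteq> []" "hd p \<noteq> \<zero>"
    using p(2) unfolding polynomial_def by auto
  then show ?thesis
    using p(3)
    \<comment> \<open>Coefficients are listed from the leading one down, so the constant term is the last entry.\<close>
  proof (induct p rule: rev_induct)
    case (snoc c q)
    have c: "c \<in> F" and q: "set q \<subseteq> F" "set q \<subseteq> carrier R"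
      using snoc.prems(1) car(2) by auto
    define y where "y = eval q x"
    have y: "y \<in> E" "y \<in> carrier R"
      using eval_in[OF q(1)] E_closed(1) by (auto simp: y_def)
    have rel: "(y \<otimes> x) \<oplus> c = \<zero>"
      using eval_append_aux[OF q(2), of c x] c car snoc.prems(4) by (auto simp: y_def)
    show ?case
    proof (cases "c = \<zero>")
      case True
      then have "y = \<zero>"
        using rel y car x(2) integral_division[of y x] by simp
      moreover have "q \<noteq> []"
        using snoc.prems(3) True by auto
      ultimately show ?thesis
        using snoc.hyps snoc.prems(3) q(1) by (simp add: y_def)
    next
      case False
      have c_car: "c \<in> carrier R"
        using c car(2) by auto
      have inv_c: "inv c \<in> F" "inv c \<otimes> c = \<one>"
        using subfield_m_inv[OF F(1), of c] c False by auto
      define z where "z = \<ominus> (inv c \<otimes> y)"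
      have z: "z \<in> E" "z \<in> carrier R"
        using inv_c(1) F(2) y(1) E_closed(1,5,6) unfolding z_def by auto
      have "y \<otimes> x = \<ominus> c"
        using rel y car c_car minus_equality by auto
      have inv_c_car: "inv c \<in> carrier R"
        using inv_c(1) car(2) by auto
      have "z \<otimes> x = \<ominus> (inv c \<otimes> (y \<otimes> x))"
        using inv_c_car y(2) car(1) unfolding z_def by (simp add: l_minus m_assoc)
      also have "\<dots> = \<one>"
        using inv_c_car c_car inv_c(2) \<open>y \<otimes> x = \<ominus> c\<close> by (simp add: r_minus)
      finally have "z \<otimes> x = \<one>" .
      then have "inv x = z"
        using z(2) car(1) x(2) by (metis m_assoc l_one r_one nonzero_inv(1,2))
      with z(1) show ?thesis by simp
    qed
  qed simp
qed

lemma (in division_ring) subring_is_subdivision_ring: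
  assumes alg: "algebraic_over_center R" and E: "subring E R" "center R \<subseteq> E"
  shows "subdivision_ring E R"
proof -
  note E_closed = subringE[OF E(1)]
  have "inv x \<in> E" if x: "x \<in> E" "x \<noteq> \<zero>" for x
  proof -
    obtain p where "p \<in> carrier ((center R)[X])" "p \<noteq> []" "eval p x = \<zero>"
      using algebraic_over_centerE[OF alg subsetD[OF E_closed(1) x(1)]] by blast
    then show ?thesis
      using inv_in_subring_of_algebraic[OF E(1) center_is_subfield E(2)] x by blast
  qed
  then have "E - {\<zero>} \<subseteq> Units (R \<lparr> carrier := E \<rparr>)"
    using E_closed(1) unfolding Units_def
    by (auto simp: subset_iff intro!: bexI[of _ "inv x" for x])
  moreover have "Units (R \<lparr> carrier := E \<rparr>) \<subseteq> E - {\<zero>}"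
    using E_closed(1) one_not_zero unfolding Units_def by force
  ultimately have "Units (R \<lparr> carrier := E \<rparr>) = E - {\<zero>}"
    by blast
  then show ?thesis
    using E(1) subring_is_ring[OF E(1)]
    unfolding subdivision_ring_def division_ring_def division_ring_axioms_def by simp
qed

section \<open>Finite-dimensional extensions\<close>

text \<open>The ring consists of the left \<open>K\<close>-combinations of \<open>1, b, \<dots>, b\<^sup>n\<^sup>-\<^sup>1\<close>, where \<open>n\<close> is the degree
  of \<open>p\<close>; the skew-commutation rule turns \<open>b k b\<^sup>i\<close> into \<open>k' b\<^sup>i\<^sup>+\<^sup>1\<close>, and \<open>p(b) = 0\<close> expresses \<open>b\<^sup>n\<close> by
  lower powers. Commutation is only asked up to a twist because the extension is meant to be
  non-commutative: conjugation by \<open>b\<close> may move the elements of \<open>K\<close>.\<close>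

lemma (in ring) finite_dimensional_skew_extension:
  assumes K: "subfield K R" and b: "b \<in> carrier R"
    and skew: "\<And>k. k \<in> K \<Longrightarrow> \<exists>k' \<in> K. b \<otimes> k = k' \<otimes> b"
    and p: "p \<in> carrier (K[X])" "p \<noteq> []" "eval p b = \<zero>"
  shows "\<exists>E. subring E R \<and> K \<subseteq> E \<and> b \<in> E \<and> finite_dimension K E"
proof -
  obtain c q where cq: "p = c # q"
    using p(2) by (cases p) auto
  have K_car: "K \<subseteq> carrier R"
    using subfieldE(3)[OF K] .
  have c: "c \<in> K - {\<zero>}" and q: "set q \<subseteq> K"
    using p(1) univ_poly_carrier[of R K p] unfolding cq polynomial_def by auto
  define n where "n = length q"
  define B where "B = exp_base b n"
  define E where "E = Span K B"
  have B: "set B \<subseteq> carrier R"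
    unfolding B_def by (rule exp_base_closed[OF b])
  have B_elem: "u \<in> set B \<longleftrightarrow> (\<exists>i < n. u = b [^] i)" for u
    unfolding B_def exp_base_def by auto
  note E_closed = Span_subgroup_props[OF K B, folded E_def]
  have smult: "k \<otimes> v \<in> E" if "k \<in> K" "v \<in> E" for k v
    using Span_smult_closed[OF K B] that unfolding E_def by blast
  have low: "b [^] i \<in> E" if "i < n" for i
    using Span_base_incl[OF K B] that B_elem unfolding E_def by blast
  have "eval q b = combine q B"
    by (simp add: B_def n_def combine_eq_eval)
  then have "eval q b \<in> E"
    using Span_eq_combine_set[OF K B] q by (auto simp: E_def)
  moreover have "c \<otimes> (b [^] n) \<oplus> eval q b = \<zero>"
    using p(3) unfolding cq n_def by simp
  ultimately have "c \<otimes> (b [^] n) \<in> E"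
    using E_closed(1) E_closed(4)[of "eval q b"]
      minus_equality[of "c \<otimes> (b [^] n)" "eval q b"] c K_car b
    by (auto simp: subset_iff)
  then have "b [^] n \<in> E"
    using Span_m_inv_simprule[OF K B c, of "b [^] n"] b unfolding E_def by simp
  with low have pow: "b [^] i \<in> E" if "i \<le> n" for i
    using that by (cases "i = n") auto
  \<comment> \<open>Since \<open>pow\<close> includes the exponent \<open>n\<close>, this also covers \<open>n = 0\<close>, where \<open>B\<close> is empty.\<close>
  have one: "\<one> \<in> E"
    using pow[of 0] by simp
  have b_left: "b \<otimes> v \<in> E" if "v \<in> E" for v
  proof -
    let ?T = "{x \<in> carrier R. b \<otimes> x \<in> E}"
    have "subgroup ?T (add_monoid R)"
      by (rule add.subgroupI) (use b E_closed in \<open>auto simp: r_minus r_distr a_inv_def[symmetric]\<close>)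
    moreover have "K <#> set B \<subseteq> ?T"
    proof
      fix x assume "x \<in> K <#> set B"
      then obtain k i where k: "k \<in> K" and i: "i < n" and x: "x = k \<otimes> b [^] i"
        unfolding set_mult_def using B_elem by auto
      obtain k' where k': "k' \<in> K" "b \<otimes> k = k' \<otimes> b"
        using skew[OF k] by blast
      have car: "k \<in> carrier R" "k' \<in> carrier R"
        using k k'(1) K_car by auto
      have "b \<otimes> x = (b \<otimes> k) \<otimes> b [^] i"
        using b car by (simp add: x m_assoc)
      also have "\<dots> = k' \<otimes> b [^] Suc i"
        unfolding nat_pow_Suc2[OF b] using b car by (simp add: k'(2) m_assoc)
      finally show "x \<in> ?T"
        using smult[OF k'(1) pow[of "Suc i"]] i b car x by simp
    qed
    ultimately have "E \<subseteq> ?T"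
      unfolding E_def by (rule Span_min[OF K B])
    with that show ?thesis by blast
  qed
  have mult: "v \<otimes> w \<in> E" if "v \<in> E" "w \<in> E" for v w
  proof -
    let ?T = "{x \<in> carrier R. x \<otimes> w \<in> E}"
    have w: "w \<in> carrier R"
      using that E_closed(1) by auto
    have "subgroup ?T (add_monoid R)"
      by (rule add.subgroupI)
        (use w E_closed in \<open>auto simp: l_minus l_distr a_inv_def[symmetric]\<close>)
    moreover have "K <#> set B \<subseteq> ?T"
    proof
      fix x assume "x \<in> K <#> set B"
      then obtain k i where k: "k \<in> K" and "i < n" and x: "x = k \<otimes> b [^] i"
        unfolding set_mult_def using B_elem by auto
      have "b [^] i \<otimes> w \<in> E"
      proof (induct i)
        case (Suc i)
        then show ?case
          unfolding nat_pow_Suc2[OF b] using b_left b w by (simp add: m_assoc)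
      qed (simp add: w that(2))
      then show "x \<in> ?T"
        using smult[OF k] k K_car b w by (auto simp: x m_assoc)
    qed
    ultimately have "E \<subseteq> ?T"
      unfolding E_def by (rule Span_min[OF K B])
    with that show ?thesis by blast
  qed
  have "subring E R"
    by (rule subringI) (use E_closed one mult in auto)
  moreover have "K \<subseteq> E"
    using smult[OF _ one] K_car by (force simp: subset_iff)
  moreover have "b \<in> E"
    using b_left[OF one] b by simp
  moreover have "finite_dimension K E"
    unfolding E_def by (rule Span_finite_dimension[OF K B])
  ultimately show ?thesis by blast
qed

text \<open>The scalars and vectors lie in \<open>E\<close>, so the larger ring forms the same spans.\<close>

lemma (in ring) finite_dimension_of_subring:
  assumes E: "subring E R" and F: "subfield F (R \<lparr> carrier := E \<rparr>)" "subfield F R"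
    and fin: "ring.finite_dimension (R \<lparr> carrier := E \<rparr>) F V"
  shows "finite_dimension F V"
proof -
  interpret S: ring "R \<lparr> carrier := E \<rparr>"
    using subring_is_ring[OF E] .
  obtain Us where "set Us \<subseteq> E" "S.Span F Us = V"
    using fin S.exists_base[OF F(1)] unfolding S.finite_dimension_def by auto
  then show ?thesis
    using Span_finite_dimension[OF F(2), of Us] Span_consistent[OF E] subringE(1)[OF E] by auto
qed

lemma (in ring) Span_mono_scalars:
  assumes "K \<subseteq> L"
  shows "Span K Us \<subseteq> Span L Us"
proof (induct Us)
  case (Cons u Us)
  with assms show ?case
    by (fastforce simp: line_extension_mem_iff)
qed simp

text \<open>A finite set spanning \<open>E\<close> over \<open>F\<close> also spans it over the larger center of \<open>E\<close>.\<close>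

lemma (in ring) centrally_finite_of_finite_dimension:
  assumes E: "subring E R" "division_ring (R \<lparr> carrier := E \<rparr>)"
    and F: "subfield F R" "F \<subseteq> center R" "F \<subseteq> E"
    and fin: "finite_dimension F E"
  shows "centrally_finite (R \<lparr> carrier := E \<rparr>)"
proof -
  interpret S: division_ring "R \<lparr> carrier := E \<rparr>"
    using E(2) .
  let ?Z = "center (R \<lparr> carrier := E \<rparr>)"
  obtain Us where Us: "set Us \<subseteq> carrier R" "Span F Us = E"
    using fin exists_base[OF F(1)] unfolding finite_dimension_def by blast
  have Us_E: "set Us \<subseteq> carrier (R \<lparr> carrier := E \<rparr>)"
    using Span_base_incl[OF F(1) Us(1)] Us(2) by simp
  have "F \<subseteq> ?Z"
    using F(2,3) subringE(1)[OF E(1)] unfolding center_def centralizer_def by auto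
  then have "E \<subseteq> S.Span ?Z Us"
    using S.Span_mono_scalars[of F ?Z Us] Us(2) Span_consistent[OF E(1)] by simp
  moreover have "S.Span ?Z Us \<subseteq> E"
    using S.Span_in_carrier[OF center_incl Us_E] by simp
  ultimately show ?thesis
    using S.Span_finite_dimension[OF S.center_is_subfield Us_E]
    unfolding centrally_finite_def by simp
qed

section \<open>Conjugation-stable subfields\<close>

lemma (in division_ring) conjugation_ring_hom:
  assumes "b \<in> carrier R" "b \<noteq> \<zero>"
  shows "ring_hom_ring R R (\<lambda>x. b \<otimes> x \<otimes> inv b)"
proof (rule ring_hom_ringI)
  fix x y assume xy: "x \<in> carrier R" "y \<in> carrier R"
  have "b \<otimes> x \<otimes> inv b \<otimes> (b \<otimes> y \<otimes> inv b) = b \<otimes> x \<otimes> (inv b \<otimes> b) \<otimes> y \<otimes> inv b"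
    using assms xy nonzero_inv(1)[of b] by (simp add: m_assoc del: nonzero_inv(2,3))
  then show "b \<otimes> (x \<otimes> y) \<otimes> inv b = b \<otimes> x \<otimes> inv b \<otimes> (b \<otimes> y \<otimes> inv b)"
    using assms xy by (simp add: m_assoc)
qed (use assms in \<open>auto simp: ring_axioms l_distr r_distr\<close>)

text \<open>Restricting to a commutative \<open>K\<close> is essential: in a division ring a polynomial over the center
  can have infinitely many roots, such as \<open>x\<^sup>2 + 1\<close> in the quaternions.\<close>

lemma (in ring) finite_roots_in_subfield:
  assumes "subfield K R" "p \<in> carrier (K[X])" "p \<noteq> []"
  shows "finite {y \<in> K. eval p y = \<zero>}"
proof -
  note K = subfieldE(1)[OF assms(1)]
  interpret L: field "R \<lparr> carrier := K \<rparr>"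
    using subfield_iff(2)[OF assms(1)] .
  have "p \<in> carrier (poly_ring (R \<lparr> carrier := K \<rparr>))"
    using assms(2) univ_poly_consistent[OF K] by simp
  from L.finite_number_of_roots[OF this] show ?thesis
    using assms(3) eval_consistent[OF K] by (simp add: L.is_root_def)
qed

lemma (in ring) subfield_of_subfield:
  assumes "subfield K R" "subfield F R" "F \<subseteq> K"
  shows "subfield F (R \<lparr> carrier := K \<rparr>)"
proof -
  interpret L: ring "R \<lparr> carrier := K \<rparr>"
    using subring_is_ring[OF subfieldE(1)[OF assms(1)]] .
  show ?thesis
    using L.subfield_iff(1)[of F] subfield_iff(2)[OF assms(2)] assms(3) by simp
qed

text \<open>Adjoining all the roots of \<open>p\<close> in \<open>K\<close>, rather than \<open>a\<close> alone, is what gives stability: conjugation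
  by \<open>b\<close> sends roots of \<open>p\<close> in \<open>K\<close> to roots of \<open>p\<close> in \<open>K\<close>, so it maps the generators of \<open>L\<close> into \<open>L\<close>.\<close>

lemma (in division_ring) finite_stable_subfield:
  assumes F: "subfield F R" and K: "subfield K R" "F \<subseteq> K"
    and b: "b \<in> carrier R" "b \<noteq> \<zero>"
    and fix_F: "\<And>x. x \<in> F \<Longrightarrow> b \<otimes> x \<otimes> inv b = x"
    and stable: "\<And>x. x \<in> K \<Longrightarrow> b \<otimes> x \<otimes> inv b \<in> K"
    and a: "a \<in> K" and p: "p \<in> carrier (F[X])" "p \<noteq> []" "eval p a = \<zero>"
  obtains L where "subfield L R" "F \<subseteq> L" "a \<in> L" "finite_dimension F L"
    "\<And>x. x \<in> L \<Longrightarrow> b \<otimes> x \<otimes> inv b \<in> L"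
proof -
  let ?c = "\<lambda>x. b \<otimes> x \<otimes> inv b"
  interpret conj: ring_hom_ring R R ?c
    using conjugation_ring_hom[OF b] .
  note K_sub = subfieldE(1)[OF K(1)] and K_car = subfieldE(3)[OF K(1)]
  interpret S: field "R \<lparr> carrier := K \<rparr>"
    using subfield_iff(2)[OF K(1)] .
  have p_coeffs: "set p \<subseteq> F"
    using p(1) univ_poly_carrier[of R F p] polynomial_incl by blast
  have "p \<in> carrier (K[X])"
    using p(1) K(2) unfolding univ_poly_def polynomial_def by auto
  then obtain xs where xs: "set xs = {y \<in> K. eval p y = \<zero>}"
    using finite_roots_in_subfield[OF K(1) _ p(2)] finite_list by blast
  \<comment> \<open>Evaluation at a point is multiplicative on polynomials only where the point commutes with
    the coefficients, so the theory of finite extensions is applied inside the commutative \<open>K\<close> and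
    its conclusions on \<open>L\<close> are then carried over to the whole ring.\<close>
  define L where "L = finite_extension F xs"
  have F_S: "subfield F (R \<lparr> carrier := K \<rparr>)"
    using subfield_of_subfield[OF K(1) F K(2)] .
  have L_eq: "L = S.finite_extension F xs"
    unfolding L_def finite_extension_consistent[OF K_sub] ..
  have xs_K: "set xs \<subseteq> carrier (R \<lparr> carrier := K \<rparr>)"
    using xs by auto
  have alg: "(S.algebraic over F) x" if "x \<in> set xs" for x
  proof (rule S.algebraicI[OF _ p(2)])
    show "p \<in> carrier (F[X]\<^bsub>R \<lparr> carrier := K \<rparr>\<^esub>)"
      using p(1) unfolding univ_poly_def polynomial_def by auto
    show "S.eval p x = \<zero>\<^bsub>R \<lparr> carrier := K \<rparr>\<^esub>"
      using that xs eval_consistent[OF K_sub] by simp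
  qed
  have "subfield L (R \<lparr> carrier := K \<rparr>)"
    unfolding L_eq by (rule S.finite_extension_is_subfield[OF F_S xs_K alg])
  then have L: "subfield L R"
    using subfield_iff(1)[of L] S.subfield_iff(2)[of L] subfieldE(3)[of L "R \<lparr> carrier := K \<rparr>"] K_car
    by auto
  have fin: "finite_dimension F L"
    using finite_dimension_of_subring[OF K_sub F_S F]
      S.finite_extension_finite_dimension(1)[OF F_S xs_K alg] unfolding L_eq by blast
  have F_L: "F \<subseteq> L"
    using S.finite_extension_incl[OF subfieldE(3)[OF F_S] xs_K] unfolding L_eq .
  have xs_L: "set xs \<subseteq> L"
    using S.finite_extension_mem[OF subfieldE(1)[OF F_S] xs_K] unfolding L_eq .
  let ?P = "{x \<in> carrier R. ?c x \<in> L}"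
  \<comment> \<open>The elements that conjugation sends into \<open>L\<close> form a subring, so it is enough to check generators.\<close>
  have "finite_extension F xs \<subseteq> ?P"
  proof (rule finite_extension_subring_incl)
    note L_closed = subringE[OF subfieldE(1)[OF L]]
    show "subring ?P R"
      by (rule subringI) (use L_closed in \<open>auto simp del: conj.hom_closed\<close>)
    show "F \<subseteq> ?P"
      using fix_F F_L subfieldE(3)[OF F] by auto
    show "set xs \<subseteq> ?P"
    proof
      fix y assume "y \<in> set xs"
      then have y: "y \<in> K" "y \<in> carrier R" "eval p y = \<zero>"
        using xs K_car by auto
      have "map ?c p = p"
        using p_coeffs fix_F by (simp add: map_idI subset_iff)
      then have "eval p (?c y) = \<zero>"
        using conj.eval_hom'[OF y(2), of p] p_coeffs subfieldE(3)[OF F] y(3) conj.hom_zero by auto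
      then show "y \<in> ?P"
        using stable[OF y(1)] xs xs_L y(2) by auto
    qed
  qed
  moreover have "a \<in> L"
    using a p(3) xs xs_L by auto
  ultimately show thesis
    using that[OF L F_L _ fin] by (auto simp: L_def)
qed

section \<open>Maximal subfields that are not self-invariant\<close>

text \<open>A field always normalizes itself, so a failure of self-invariance comes from a normalizing
  element outside \<open>K\<close>, which by maximality cannot commute with all of \<open>K\<close>.\<close>

lemma (in division_ring) maximal_subfield_not_self_invariantE:
  assumes "maximal_subfield K R" "\<not> self_invariant K R"
  obtains a b where "a \<in> K" "b \<in> carrier R" "b \<noteq> \<zero>" "b \<otimes> a \<noteq> a \<otimes> b"
    "\<And>x. x \<in> K \<Longrightarrow> b \<otimes> x \<otimes> inv b \<in> K"
proof -
  have K: "subfield K R" and cent: "centralizer R K = K"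
    using assms(1) unfolding maximal_subfield_def by auto
  note K_car = subfieldE(3)[OF K]
  have "K \<subseteq> mult_normalizer R (K - {\<zero>}) \<union> {\<zero>}"
  proof
    fix k assume k: "k \<in> K"
    have "k \<otimes> x \<otimes> inv k = x" if x: "x \<in> K" and "k \<noteq> \<zero>" for x
    proof -
      have car: "k \<in> carrier R" "x \<in> carrier R"
        using k x K_car by auto
      then have "k \<otimes> x \<otimes> inv k = x \<otimes> (k \<otimes> inv k)"
        using subfieldE(4)[OF K k x] nonzero_inv(1)[OF car(1) \<open>k \<noteq> \<zero>\<close>]
        by (simp add: m_assoc del: nonzero_inv)
      then show ?thesis
        using car \<open>k \<noteq> \<zero>\<close> by simp
    qed
    then show "k \<in> mult_normalizer R (K - {\<zero>}) \<union> {\<zero>}"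
      using k K_car unfolding mult_normalizer_def by auto
  qed
  then obtain b where b: "b \<in> mult_normalizer R (K - {\<zero>})" "b \<notin> K"
    using assms(2) subringE(2)[OF subfieldE(1)[OF K]] unfolding self_invariant_def by blast
  then have b_car: "b \<in> carrier R" "b \<noteq> \<zero>"
    unfolding mult_normalizer_def by auto
  obtain a where "a \<in> K" "b \<otimes> a \<noteq> a \<otimes> b"
    using b(2) b_car cent unfolding centralizer_def by blast
  moreover have "b \<otimes> x \<otimes> inv b \<in> K" if "x \<in> K" for x
    using b(1) b_car that subringE(2)[OF subfieldE(1)[OF K]]
    unfolding mult_normalizer_def by (cases "x = \<zero>") auto
  ultimately show thesis
    using that b_car by blast
qed

theorem theorem18:
  fixes D :: "('a, 'b) ring_scheme"
  assumes "division_ring D"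
    and "algebraic_over_center D"
  shows "(\<forall>K. maximal_subfield K D \<longrightarrow> self_invariant K D) \<or>
    (\<exists>E. subdivision_ring E D \<and> noncommutative (D \<lparr> carrier := E \<rparr>) \<and>
      centrally_finite (D \<lparr> carrier := E \<rparr>))"
proof -
  interpret D: division_ring D
    using assms(1) .
  let ?F = "center D"
  note F = D.center_is_subfield
  have annihilator: "\<exists>p \<in> carrier (?F[X]\<^bsub>D\<^esub>). p \<noteq> [] \<and> D.eval p x = \<zero>\<^bsub>D\<^esub>" if "x \<in> carrier D" for x
    using D.algebraic_over_centerE[OF assms(2) that] by blast
  have "\<exists>E. subdivision_ring E D \<and> noncommutative (D \<lparr> carrier := E \<rparr>) \<and>
      centrally_finite (D \<lparr> carrier := E \<rparr>)"
    if K: "maximal_subfield K D" "\<not> self_invariant K D" for K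
  proof -
    from K have K_sub: "subfield K D" "?F \<subseteq> K"
      unfolding maximal_subfield_def by auto
    obtain a b where a: "a \<in> K" and b: "b \<in> carrier D" "b \<noteq> \<zero>\<^bsub>D\<^esub>"
      and noncomm: "b \<otimes>\<^bsub>D\<^esub> a \<noteq> a \<otimes>\<^bsub>D\<^esub> b"
      and stable: "\<And>x. x \<in> K \<Longrightarrow> b \<otimes>\<^bsub>D\<^esub> x \<otimes>\<^bsub>D\<^esub> inv\<^bsub>D\<^esub> b \<in> K"
      using D.maximal_subfield_not_self_invariantE[OF K] by metis
    have fix_F: "b \<otimes>\<^bsub>D\<^esub> x \<otimes>\<^bsub>D\<^esub> inv\<^bsub>D\<^esub> b = x" if "x \<in> ?F" for x
    proof -
      have x: "x \<in> carrier D"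
        using that center_incl[of D] by blast
      then show ?thesis
        using center_comm[OF that b(1)] b by (metis D.m_assoc D.r_one D.nonzero_inv(1,2))
    qed
    have "a \<in> carrier D"
      using a subfieldE(3)[OF K_sub(1)] by blast
    then obtain p where p: "p \<in> carrier (?F[X]\<^bsub>D\<^esub>)" "p \<noteq> []" "D.eval p a = \<zero>\<^bsub>D\<^esub>"
      using annihilator by blast
    obtain L where L: "subfield L D" "?F \<subseteq> L" "a \<in> L" "D.finite_dimension ?F L"
      and L_stable: "\<And>x. x \<in> L \<Longrightarrow> b \<otimes>\<^bsub>D\<^esub> x \<otimes>\<^bsub>D\<^esub> inv\<^bsub>D\<^esub> b \<in> L"
      using D.finite_stable_subfield[OF F K_sub b fix_F stable a p] by blast
    have skew: "\<exists>x' \<in> L. b \<otimes>\<^bsub>D\<^esub> x = x' \<otimes>\<^bsub>D\<^esub> b" if "x \<in> L" for x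
    proof
      show "b \<otimes>\<^bsub>D\<^esub> x = (b \<otimes>\<^bsub>D\<^esub> x \<otimes>\<^bsub>D\<^esub> inv\<^bsub>D\<^esub> b) \<otimes>\<^bsub>D\<^esub> b"
        using that subfieldE(3)[OF L(1)] b by (auto simp: D.m_assoc)
    qed (rule L_stable[OF that])
    obtain q where q: "q \<in> carrier (?F[X]\<^bsub>D\<^esub>)" "q \<noteq> []" "D.eval q b = \<zero>\<^bsub>D\<^esub>"
      using annihilator b(1) by blast
    then have "q \<in> carrier (L[X]\<^bsub>D\<^esub>)"
      using L(2) unfolding univ_poly_def polynomial_def by auto
    then obtain E where E: "subring E D" "L \<subseteq> E" "b \<in> E" "D.finite_dimension L E"
      using D.finite_dimensional_skew_extension[OF L(1) b(1) skew _ q(2,3)] by blast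
    have F_E: "?F \<subseteq> E"
      using L(2) E(2) by blast
    have sub: "subdivision_ring E D"
      using D.subring_is_subdivision_ring[OF assms(2) E(1) F_E] .
    have "D.finite_dimension ?F E"
      using D.telescopic_base[OF F L(1)] L(4) E(4) unfolding D.finite_dimension_def by blast
    then have "centrally_finite (D \<lparr> carrier := E \<rparr>)"
      using D.centrally_finite_of_finite_dimension[OF E(1) _ F _ F_E] sub
      unfolding subdivision_ring_def by blast
    moreover have "noncommutative (D \<lparr> carrier := E \<rparr>)"
      using noncomm L(3) E(2,3) unfolding noncommutative_def by auto
    ultimately show ?thesis
      using sub by blast
  qed
  then show ?thesis by blast
qed

end
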